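(* For every integer $n\ge 1$: (a) for every $d\ge 1$, $f(n,d)=n$; (b) for every $d\ge 1$, $f(n,d,2)=n+\lceil n/d\rceil$; (c) for every $d\ge 3$ there is a constant $C_d$ depending only on $d$ such that $\left|f(n,d,3)-\left(1+\frac{2}{d-1}\right)n\right|\le C_d$ for all $n\ge 1$.
   Context: For integers $d\ge 1$, $n\ge 1$, $T_d(n)=\{(x_1,\dots,x_d)\in\mathbb{Z}_{\ge 0}^d : x_1+\dots+x_d\le n-1\}$. A $k$-cover of $T_d(n)$ is a finite multiset of affine hyperplanes in $\mathbb{R}^d$ such that every point of $T_d(n)$ lies in at least $k$ of them (with multiplicity). $f(n,d,k)$ is the minimum cardinality of a $k$-cover of $T_d(n)$, and $f(n,d)=f(n,d,1)$. *)

theory Defs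
  imports Complex_Main "HOL-Library.Multiset"
begin

text \<open>Points of R^d are represented as functions nat => real, only coordinates 0..d-1
  being relevant.  An affine hyperplane in R^d is given by a pair (a, b) with
  a restricted to coordinates < d not identically zero; it is the set
  {x. sum_{i<d} a i * x i = b}.\<close>

definition is_hyperplane :: "nat \<Rightarrow> ((nat \<Rightarrow> real) \<times> real) \<Rightarrow> bool" where
  "is_hyperplane d h \<longleftrightarrow> (\<exists>i<d. fst h i \<noteq> 0)"

definition on_hyperplane :: "nat \<Rightarrow> ((nat \<Rightarrow> real) \<times> real) \<Rightarrow> (nat \<Rightarrow> real) \<Rightarrow> bool" where
  "on_hyperplane d h x \<longleftrightarrow> (\<Sum>i<d. fst h i * x i) = snd h"

definition T :: "nat \<Rightarrow> nat \<Rightarrow> (nat \<Rightarrow> real) set" where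
  "T d n = {x. (\<forall>i<d. \<exists>m::nat. x i = real m) \<and> (\<forall>i\<ge>d. x i = 0) \<and>
               (\<Sum>i<d. x i) \<le> real n - 1}"

definition is_k_cover :: "nat \<Rightarrow> nat \<Rightarrow> nat \<Rightarrow> ((nat \<Rightarrow> real) \<times> real) multiset \<Rightarrow> bool" where
  "is_k_cover n d k M \<longleftrightarrow> (\<forall>h\<in>#M. is_hyperplane d h) \<and>
     (\<forall>x\<in>T d n. size (filter_mset (\<lambda>h. on_hyperplane d h x) M) \<ge> k)"

definition f3 :: "nat \<Rightarrow> nat \<Rightarrow> nat \<Rightarrow> nat" where
  "f3 n d k = (LEAST m. \<exists>M. is_k_cover n d k M \<and> size M = m)"

definition f :: "nat \<Rightarrow> nat \<Rightarrow> nat" where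
  "f n d = f3 n d 1"

end

(*
  In barycentric coordinates x_0, ..., x_d the upper bounds take the slabs x_i = c, c < m_i:
  a point escaping the slabs of all i in B has sum over B of m_i at most n - 1.

  Lower bounds: fix a facet direction i. If some plane x_i = c is absent from the cover, the cover
  restricts to a k-fold cover of the slice x_i = c, a grid of dimension d - 1 and size n - c, in
  which the members parallel to x_i = 0 play no part; for the first such c there are at least c of
  these. If the planes x_i = c are all present for c < m, then deleting them costs one unit of
  multiplicity. This settles k = 1 and k = 2, and reduces k = 3, d > 3 to d = 3 by considering
  all d + 1 directions at once.

  For k = d = 3 let L be the size of the cover and e = 2n - L. For each of the three ways to split
  the four coordinates as {i,j}, {k,l}, let S be the number of members of the form x_i + x_j = s
  (equivalently x_k + x_l = n - 1 - s) and U the number of members parallel to one of the two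
  edge directions e_i - e_j, e_k - e_l. Counting incidences on lines parallel to an edge, and then
  on the points of the line x_i + x_j = s of a projected triangle, forces x_i + x_j = s into the
  cover for all s in an interval of length about (S + e)/2; exchanging the pairs gives a second
  interval, and the overlap of the two has length about (S + U - L + e)/2. As their union has at
  most S elements, L + e <= S + U + O(1) and e <= S. The members of the other two splittings of
  type S are not counted in U, so S1 >= S2 + S3 + e - O(1) for every ordering of the three
  splittings; adding two of these bounds e.
*)

theory Submission
  imports Defs
begin

section \<open>Covers of the simplex grid in barycentric coordinates, and their slices\<close>

definition inc :: "'i set \<Rightarrow> ('j \<Rightarrow> 'i \<Rightarrow> real) \<Rightarrow> ('j \<Rightarrow> real) \<Rightarrow> ('i \<Rightarrow> nat) \<Rightarrow> 'j \<Rightarrow> bool" where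
  "inc I a b x j \<longleftrightarrow> (\<Sum>i\<in>I. a j i * real (x i)) = b j"

text \<open>The index set \<open>I\<close> carries the barycentric coordinates, so it has \<open>d + 1\<close> elements, and \<open>N = n - 1\<close>.
  A form that is constant on \<open>I\<close> is constant on the grid, hence not a hyperplane.\<close>

definition covers :: "'i set \<Rightarrow> nat \<Rightarrow> nat \<Rightarrow> 'j set \<Rightarrow> ('j \<Rightarrow> 'i \<Rightarrow> real) \<Rightarrow> ('j \<Rightarrow> real) \<Rightarrow> bool" where
  "covers I N k J a b \<longleftrightarrow> finite J \<and> (\<forall>j\<in>J. \<exists>p\<in>I. \<exists>q\<in>I. a j p \<noteq> a j q) \<and>
     (\<forall>x. sum x I = N \<longrightarrow> k \<le> card {j\<in>J. inc I a b x j})"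

text \<open>On the grid, where the coordinates sum to \<open>N\<close>, a form that is constant off
  \<open>i\<close> depends on \<open>x i\<close> alone; a member of a cover with this property is
  parallel to the facet \<open>x i = 0\<close>.\<close>

definition par :: "'i set \<Rightarrow> ('j \<Rightarrow> 'i \<Rightarrow> real) \<Rightarrow> 'i \<Rightarrow> 'j \<Rightarrow> bool" where
  "par I a i j \<longleftrightarrow> (\<forall>p\<in>I - {i}. \<forall>q\<in>I - {i}. a j p = a j q)"

text \<open>These are the members that cut out \<open>x i = c\<close>. Asking for an incident grid
  point avoids normalising the form, which the grid determines only up to scaling and up to adding a
  constant to all its coefficients.\<close>

definition level :: "'i set \<Rightarrow> nat \<Rightarrow> 'j set \<Rightarrow> ('j \<Rightarrow> 'i \<Rightarrow> real) \<Rightarrow> ('j \<Rightarrow> real) \<Rightarrow> 'i \<Rightarrow> nat \<Rightarrow> 'j set" where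
  "level I N J a b i c = {j\<in>J. par I a i j \<and> (\<exists>x. sum x I = N \<and> x i = c \<and> inc I a b x j)}"

lemma covers_finite: "covers I N k J a b \<Longrightarrow> finite J"
  by (simp add: covers_def)

lemma covers_count: "covers I N k J a b \<Longrightarrow> sum x I = N \<Longrightarrow> k \<le> card {j\<in>J. inc I a b x j}"
  by (simp add: covers_def)

lemma covers_nonconst: "covers I N k J a b \<Longrightarrow> j \<in> J \<Longrightarrow> \<exists>p\<in>I. \<exists>q\<in>I. a j p \<noteq> a j q"
  by (simp add: covers_def)

text \<open>With common value \<open>a j p\<close> off \<open>i\<close>, the form evaluates on the
  grid to \<open>a j p * N + (a j i - a j p) * x i\<close>. The coefficient of \<open>x i\<close> is
  nonzero because the form is not constant on \<open>I\<close>.\<close>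

lemma level_unique:
  assumes cov: "covers I N k J a b" and I: "finite I" "i \<in> I"
    and j: "j \<in> level I N J a b i c" and x: "sum x I = N" "inc I a b x j"
  shows "x i = c"
proof -
  from j obtain y where y: "sum y I = N" "y i = c" "inc I a b y j" and jJ: "j \<in> J" and par: "par I a i j"
    by (auto simp: level_def)
  obtain u v where "u \<in> I" "v \<in> I" "a j u \<noteq> a j v"
    using covers_nonconst[OF cov jJ] by blast
  then have "\<exists>p\<in>I. a j p \<noteq> a j i" by metis
  then obtain p where p: "p \<in> I - {i}" "a j p \<noteq> a j i" by blast
  have ev: "(\<Sum>t\<in>I. a j t * real (z t)) = a j p * real N + (a j i - a j p) * real (z i)"
    if "sum z I = N" for z
  proof -
    have "(\<Sum>t\<in>I. a j t * real (z t)) = a j i * real (z i) + (\<Sum>t\<in>I-{i}. a j t * real (z t))"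
      using I by (simp add: sum.remove)
    also have "(\<Sum>t\<in>I-{i}. a j t * real (z t)) = (\<Sum>t\<in>I-{i}. a j p * real (z t))"
      using par p unfolding par_def by (intro sum.cong refl) (metis (no_types))
    also have "\<dots> = a j p * (real N - real (z i))"
    proof -
      have "real N = (\<Sum>t\<in>I. real (z t))" using that by auto
      also have "\<dots> = real (z i) + (\<Sum>t\<in>I-{i}. real (z t))"
        using I by (simp add: sum.remove)
      finally show ?thesis by (simp add: sum_distrib_left)
    qed
    finally show ?thesis by (simp add: algebra_simps)
  qed
  have "(a j i - a j p) * real (x i) = (a j i - a j p) * real (y i)"
    using ev[OF x(1)] ev[OF y(1)] x(2) y(3) unfolding inc_def by linarith
  with p(2) y(2) show ?thesis by simp
qed

text \<open>Substituting \<open>x i = c\<close> moves \<open>a j i * c\<close> to the right-hand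
  side. By \<open>lev\<close> no parallel member meets the slice, so dropping these keeps every
  multiplicity; the other members stay nonconstant on \<open>I - {i}\<close>.\<close>

lemma covers_slice:
  assumes cov: "covers I N k J a b" and I: "finite I" "i \<in> I" and c: "c \<le> N"
    and lev: "level I N J a b i c = {}"
  shows "covers (I - {i}) (N - c) k {j\<in>J. \<not> par I a i j} a (\<lambda>j. b j - a j i * real c)"
  unfolding covers_def
proof (intro conjI allI impI ballI)
  show "finite {j\<in>J. \<not> par I a i j}" using covers_finite[OF cov] by simp
next
  fix j assume "j \<in> {j\<in>J. \<not> par I a i j}"
  then show "\<exists>p\<in>I - {i}. \<exists>q\<in>I - {i}. a j p \<noteq> a j q" by (auto simp: par_def)
next
  fix x :: "'a \<Rightarrow> nat" assume x: "sum x (I - {i}) = N - c"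
  let ?y = "x(i := c)"
  have "sum ?y (I - {i}) = sum x (I - {i})" by (rule sum.cong) auto
  then have y: "sum ?y I = N" using x c I by (simp add: sum.remove)
  have "(\<Sum>t\<in>I. a j t * real (?y t)) = a j i * real c + (\<Sum>t\<in>I-{i}. a j t * real (x t))" for j
  proof -
    have "(\<Sum>t\<in>I-{i}. a j t * real (?y t)) = (\<Sum>t\<in>I-{i}. a j t * real (x t))"
      by (rule sum.cong) auto
    then show ?thesis using I by (simp add: sum.remove)
  qed
  then have inc: "inc I a b ?y j \<longleftrightarrow> inc (I - {i}) a (\<lambda>j. b j - a j i * real c) x j" for j
    by (auto simp: inc_def)
  have "\<not> par I a i j" if "j \<in> J" "inc I a b ?y j" for j
  proof
    assume "par I a i j"
    then have "j \<in> level I N J a b i c"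
      unfolding level_def using that y by (auto intro!: exI[of _ ?y])
    then show False using lev by simp
  qed
  then have "{j\<in>J. inc I a b ?y j} = {j\<in>{j\<in>J. \<not> par I a i j}. inc (I - {i}) a (\<lambda>j. b j - a j i * real c) x j}"
    using inc by auto
  then show "k \<le> card {j\<in>{j\<in>J. \<not> par I a i j}. inc (I - {i}) a (\<lambda>j. b j - a j i * real c) x j}"
    using covers_count[OF cov y] by simp
qed

text \<open>One member is picked from each level in \<open>C\<close>. A grid point determines its
  own level, so deleting \<open>Q\<close> lowers each multiplicity by at most one.\<close>

lemma levels_transversal:
  assumes cov: "covers I N k J a b" and I: "finite I" "i \<in> I" and C: "finite C"
    and lev: "\<And>c. c \<in> C \<Longrightarrow> level I N J a b i c \<noteq> {}"
  shows "\<exists>Q\<subseteq>{j\<in>J. par I a i j}. card Q = card C \<and>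
    (\<forall>x. sum x I = N \<longrightarrow> card {j\<in>Q. inc I a b x j} \<le> 1)"
proof -
  define g where "g c = (SOME j. j \<in> level I N J a b i c)" for c
  have g: "g c \<in> level I N J a b i c" if "c \<in> C" for c
    using lev[OF that] unfolding g_def by (simp add: some_in_eq)
  have lv: "x i = c" if "c \<in> C" "sum x I = N" "inc I a b x (g c)" for x c
    using level_unique[OF cov I g] that by blast
  have inj: "inj_on g C"
  proof (rule inj_onI)
    fix c c' assume *: "c \<in> C" "c' \<in> C" "g c = g c'"
    obtain x where "sum x I = N" "x i = c" "inc I a b x (g c)"
      using g[OF *(1)] by (auto simp: level_def)
    then show "c = c'" using lv[OF *(2), of x] * by simp
  qed
  have "card {j\<in>g ` C. inc I a b x j} \<le> 1" if "sum x I = N" for x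
  proof -
    have "{j\<in>g ` C. inc I a b x j} \<subseteq> {g (x i)}" using lv that by auto
    then show ?thesis using card_mono[of "{g (x i)}"] by fastforce
  qed
  moreover have "g ` C \<subseteq> {j\<in>J. par I a i j}" using g by (auto simp: level_def)
  ultimately show ?thesis using card_image[OF inj] by blast
qed

lemma levels_card:
  assumes cov: "covers I N k J a b" and I: "finite I" "i \<in> I" and C: "finite C"
    and lev: "\<And>c. c \<in> C \<Longrightarrow> level I N J a b i c \<noteq> {}"
  shows "card C \<le> card {j\<in>J. par I a i j}"
proof -
  obtain Q where "Q \<subseteq> {j\<in>J. par I a i j}" "card Q = card C"
    using levels_transversal[OF assms] by blast
  then show ?thesis using card_mono[of "{j\<in>J. par I a i j}" Q] covers_finite[OF cov] by simp
qed

lemma card_par_split: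
  assumes "covers I N k J a b"
  shows "card J = card {j\<in>J. par I a i j} + card {j\<in>J. \<not> par I a i j}"
proof -
  have "J = {j\<in>J. par I a i j} \<union> {j\<in>J. \<not> par I a i j}" by auto
  then show ?thesis using card_Un_disjoint[of "{j\<in>J. par I a i j}" "{j\<in>J. \<not> par I a i j}"]
    covers_finite[OF assms] by auto
qed

section \<open>Lower bounds for multiplicities 1 and 2\<close>

lemma no_covers_singleton:
  assumes "covers {i} N k J a b" "k > 0"
  shows False
proof -
  have "J = {}" using covers_nonconst[OF assms(1)] by auto
  then show False using covers_count[OF assms(1), of "\<lambda>_. N"] assms(2) by simp
qed

lemma first_empty_level:
  fixes L :: "nat \<Rightarrow> 'j set"
  assumes "L c = {}"
  obtains m where "m \<le> c" "L m = {}" "\<And>c'. c' < m \<Longrightarrow> L c' \<noteq> {}"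
proof
  show "(LEAST c. L c = {}) \<le> c" using assms by (rule Least_le)
  show "L (LEAST c. L c = {}) = {}" using assms by (rule LeastI)
  show "\<And>c'. c' < (LEAST c. L c = {}) \<Longrightarrow> L c' \<noteq> {}" using not_less_Least by blast
qed

text \<open>Either all \<open>N + 1\<close> levels in one direction are occupied, or the first empty
  level \<open>m\<close> yields \<open>m\<close> parallel members, and by induction its slice needs
  \<open>N - m + 1\<close> others.\<close>

lemma covers_1_lower:
  assumes "covers I N 1 J a b" and "card I = Suc d"
  shows "N + 1 \<le> card J"
  using assms
proof (induction d arbitrary: I N J b)
  case 0
  then obtain i where "I = {i}" by (metis One_nat_def card_1_singletonE)
  then show ?case using no_covers_singleton 0 by fastforce
next
  case (Suc d)
  then have I: "finite I" by (metis card.infinite nat.distinct(1))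
  obtain i where i: "i \<in> I" using Suc.prems(2) by fastforce
  show ?case
  proof (cases "\<exists>c\<le>N. level I N J a b i c = {}")
    case False
    then have "card {..N} \<le> card {j\<in>J. par I a i j}"
      by (intro levels_card[OF Suc.prems(1) I i]) auto
    then show ?thesis using card_par_split[OF Suc.prems(1), of i] by simp
  next
    case True
    then obtain c where c: "c \<le> N" "level I N J a b i c = {}" by blast
    obtain m where m: "m \<le> c" "level I N J a b i m = {}" "\<And>c'. c' < m \<Longrightarrow> level I N J a b i c' \<noteq> {}"
      using first_empty_level[of "level I N J a b i", OF c(2)] by blast
    have "m \<le> card {j\<in>J. par I a i j}"
      using levels_card[OF Suc.prems(1) I i, of "{..<m}"] m by simp
    moreover have "N - m + 1 \<le> card {j\<in>J. \<not> par I a i j}"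
      using Suc.IH[OF covers_slice[OF Suc.prems(1) I i _ m(2)]] m c Suc.prems(2) I i by simp
    ultimately show ?thesis using card_par_split[OF Suc.prems(1), of i] m c by simp
  qed
qed

text \<open>This is the bound \<open>n + n / d\<close> for \<open>n = N + 1\<close>, cleared of
  denominators. In each step either enough initial levels can be deleted to leave a 1-cover, or an
  early empty level allows slicing.\<close>

lemma covers_2_lower:
  assumes "covers I N 2 J a b" and "card I = Suc d"
  shows "(d + 1) * (N + 1) \<le> d * card J"
  using assms
proof (induction d arbitrary: I N J b)
  case 0
  then obtain i where "I = {i}" by (metis One_nat_def card_1_singletonE)
  then show ?case using no_covers_singleton 0 by fastforce
next
  case (Suc d)
  then have I: "finite I" by (metis card.infinite nat.distinct(1))
  obtain i where i: "i \<in> I" using Suc.prems(2) by fastforce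
  show ?case
  proof (cases "\<exists>c. Suc d * c < N + 1 \<and> level I N J a b i c = {}")
    case False
    \<comment> \<open>This is the ceiling of \<open>(N + 1) / Suc d\<close>, where
      \<open>Suc d\<close> is the current dimension.\<close>
    define m where "m = N div Suc d + 1"
    have "Suc d * c < N + 1" if "c < m" for c
    proof -
      have "Suc d * c \<le> Suc d * (N div Suc d)" by (rule mult_le_mono2) (use that m_def in simp)
      also have "\<dots> \<le> N" by (rule times_div_less_eq_dividend)
      finally show ?thesis by simp
    qed
    then obtain Q where Q: "Q \<subseteq> {j\<in>J. par I a i j}" "card Q = m"
      "\<And>x. sum x I = N \<Longrightarrow> card {j\<in>Q. inc I a b x j} \<le> 1"
      using levels_transversal[OF Suc.prems(1) I i, of "{..<m}"] False by auto
    have fQ: "finite Q" using Q(1) covers_finite[OF Suc.prems(1)] by (auto intro: finite_subset)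
    have "covers I N 1 (J - Q) a b"
      unfolding covers_def
    proof (intro conjI ballI allI impI)
      show "finite (J - Q)" using covers_finite[OF Suc.prems(1)] by simp
      show "\<exists>p\<in>I. \<exists>q\<in>I. a j p \<noteq> a j q" if "j \<in> J - Q" for j
        using covers_nonconst[OF Suc.prems(1)] that by blast
      fix x :: "'a \<Rightarrow> nat" assume x: "sum x I = N"
      have "{j \<in> J - Q. inc I a b x j} = {j\<in>J. inc I a b x j} - {j\<in>Q. inc I a b x j}" by auto
      then have "card {j \<in> J - Q. inc I a b x j} = card {j\<in>J. inc I a b x j} - card {j\<in>Q. inc I a b x j}"
        using Q(1) fQ by (simp add: card_Diff_subset subset_iff)
      then show "1 \<le> card {j \<in> J - Q. inc I a b x j}"
        using covers_count[OF Suc.prems(1) x] Q(3)[OF x] by simp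
    qed
    from covers_1_lower[OF this Suc.prems(2)] have "N + 1 \<le> card (J - Q)" .
    moreover have "card (J - Q) = card J - m" "m \<le> card J"
      using Q fQ covers_finite[OF Suc.prems(1)] card_mono[of J Q] by (auto simp: card_Diff_subset subset_iff)
    ultimately have L: "N + 1 + m \<le> card J" by simp
    have "N + 1 \<le> Suc d * m"
      using dividend_less_times_div[of "Suc d" N] by (simp add: m_def)
    then have "(Suc d + 1) * (N + 1) \<le> Suc d * (N + 1 + m)"
      by (simp add: algebra_simps)
    also have "\<dots> \<le> Suc d * card J" using L by (rule mult_le_mono2)
    finally show ?thesis .
  next
    case True
    then obtain c where c: "Suc d * c < N + 1" "level I N J a b i c = {}" by blast
    obtain m where m: "m \<le> c" "level I N J a b i m = {}" "\<And>c'. c' < m \<Longrightarrow> level I N J a b i c' \<noteq> {}"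
      using first_empty_level[of "level I N J a b i", OF c(2)] by blast
    have dm: "Suc d * m \<le> N" using mult_le_mono2[OF m(1), of "Suc d"] c(1) by linarith
    then have mN: "m \<le> N" by simp
    have A: "m \<le> card {j\<in>J. par I a i j}"
      using levels_card[OF Suc.prems(1) I i, of "{..<m}"] m by simp
    have B: "(d + 1) * (N - m + 1) \<le> d * card {j\<in>J. \<not> par I a i j}"
      using Suc.IH[OF covers_slice[OF Suc.prems(1) I i _ m(2)]] mN Suc.prems(2) I i by simp
    obtain r where r: "N = m + r" using mN le_Suc_ex by blast
    have "d * m + (d + 1) * (N - m + 1) \<le> d * card J"
      unfolding card_par_split[OF Suc.prems(1), of i] distrib_left[of d]
      by (rule add_mono[OF mult_le_mono2[OF A] B])
    then have "d * m + (d + 1) * (r + 1) \<le> d * card J" by (simp add: r)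
    then have C: "Suc d * (d * m + (d + 1) * (r + 1)) \<le> Suc d * (d * card J)"
      by (rule mult_le_mono2)
    \<comment> \<open>The right side exceeds the left by \<open>r + 1 - d * m\<close>, which is
      positive since \<open>dm\<close> says \<open>d * m \<le> r\<close>.\<close>
    have "d * ((d + 2) * (N + 1)) \<le> Suc d * (d * m + (d + 1) * (r + 1))"
      using dm unfolding r by (simp add: algebra_simps)
    also note C
    also have "Suc d * (d * card J) = d * (Suc d * card J)" by (simp only: ac_simps)
    finally have "d * ((d + 2) * (N + 1)) \<le> d * (Suc d * card J)" .
    moreover have "d > 0" using B by (cases "d = 0") auto
    ultimately have "(d + 2) * (N + 1) \<le> Suc d * card J" by (simp only: mult_le_cancel1)
    then show ?thesis by simp
  qed
qed

section \<open>Multiplicity 3 in dimension 3\<close>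

text \<open>Each \<open>h\<close> meets at most one point of \<open>X\<close>, so the incidence sets
  of the points are disjoint subsets of \<open>H\<close>.\<close>

lemma incidence_bound:
  assumes fin: "finite X" "finite H"
    and le1: "\<And>h x y. h \<in> H \<Longrightarrow> x \<in> X \<Longrightarrow> y \<in> X \<Longrightarrow> R h x \<Longrightarrow> R h y \<Longrightarrow> x = y"
    and ge: "\<And>x. x \<in> X \<Longrightarrow> r \<le> card {h\<in>H. R h x}"
  shows "r * card X \<le> card H"
proof -
  have "r * card X = (\<Sum>x\<in>X. r)" by simp
  also have "\<dots> \<le> (\<Sum>x\<in>X. card {h\<in>H. R h x})" by (rule sum_mono) (use ge in auto)
  also have "\<dots> = card (\<Union>x\<in>X. {h\<in>H. R h x})"
    by (rule card_UN_disjoint[symmetric]) (use fin le1 in auto)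
  also have "\<dots> \<le> card H" by (rule card_mono) (use fin in auto)
  finally show ?thesis .
qed

lemma card_Diff_finite_subset:
  "finite A \<Longrightarrow> B \<subseteq> A \<Longrightarrow> card (A - B) = card A - card B"
  by (simp add: card_Diff_subset finite_subset)

text \<open>The conclusion says that the plane \<open>x i + x j = s\<close> belongs to the cover.
  Two incidence counts give this: \<open>long\<close> settles lines along the edge direction of
  \<open>k\<close> and \<open>l\<close>, and \<open>wide\<close> settles the line of points left
  after projecting along that direction.\<close>

lemma tetrahedron_pair_level:
  assumes cov: "covers {i, j, k, l} N 3 J a b" and dist: "distinct [i, j, k, l]"
    and s: "s \<le> N"
    and long: "card J < card {h\<in>J. a h k = a h l} + 2 * (N + 1 - s)"
    and wide: "card {h\<in>J. a h k = a h l} < card {h\<in>J. a h i = a h j \<and> a h k = a h l} + 2 * (s + 1)"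
  shows "\<exists>h\<in>J. a h i = a h j \<and> a h k = a h l \<and> a h i * real s + a h k * real (N - s) = b h"
proof (rule ccontr)
  assume no: "\<not> ?thesis"
  define I where "I = {i, j, k, l}"
  define Q where "Q = {h\<in>J. a h k = a h l}"
  define S where "S = {h\<in>J. a h i = a h j \<and> a h k = a h l}"
  have fJ: "finite J" using covers_finite[OF cov] .
  have SQ: "S \<subseteq> Q" "Q \<subseteq> J" "finite Q" using fJ by (auto simp: S_def Q_def)
  \<comment> \<open>These are the grid points with \<open>x i + x j = s\<close>; for fixed
    \<open>c\<close>, varying \<open>t\<close> runs along the edge direction of \<open>k\<close> and
    \<open>l\<close>.\<close>
  define pt where "pt c t = (\<lambda>_. 0::nat)(i := c, j := s - c, k := t, l := N - s - t)" for c t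
  have ev: "(\<Sum>u\<in>I. a h u * real (pt c t u)) =
      a h i * real c + a h j * real (s - c) + a h k * real t + a h l * real (N - s - t)" for h c t
    using dist by (simp add: I_def pt_def)
  have pt: "sum (pt c t) I = N" if "c \<le> s" "t \<le> N - s" for c t
    using dist s that by (simp add: I_def pt_def)
  \<comment> \<open>A member of \<open>Q\<close> contains the whole line or misses it, and any other
    member meets it at most once. With fewer than two from \<open>Q\<close>, each of the
    \<open>N - s + 1\<close> points needs two from \<open>J - Q\<close>, against
    \<open>long\<close>.\<close>
  have two: "2 \<le> card {h\<in>Q. inc I a b (pt c 0) h}" if c: "c \<le> s" for c
  proof (rule ccontr)
    assume *: "\<not> ?thesis"
    have same: "inc I a b (pt c t) h \<longleftrightarrow> inc I a b (pt c 0) h" if "h \<in> Q" "t \<le> N - s" for h t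
    proof -
      have "real (N - s - t) = real (N - s) - real t" using that by (simp add: of_nat_diff)
      then have "a h k * real t + a h l * real (N - s - t) = a h l * real (N - s)"
        using that by (simp add: Q_def right_diff_distrib)
      then show ?thesis by (simp add: inc_def ev add.assoc)
    qed
    have "2 * card {..N - s} \<le> card (J - Q)"
    proof (rule incidence_bound[where R = "\<lambda>h t. inc I a b (pt c t) h"])
      fix h t t' assume h: "h \<in> J - Q" and t: "t \<in> {..N - s}" "t' \<in> {..N - s}"
        and inc: "inc I a b (pt c t) h" "inc I a b (pt c t') h"
      have "a h k * real t + a h l * (real (N - s) - real t) = a h k * real t' + a h l * (real (N - s) - real t')"
      proof -
        have "real (N - s - t) = real (N - s) - real t" "real (N - s - t') = real (N - s) - real t'"
          using t by (simp_all add: of_nat_diff)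
        then show ?thesis using inc by (simp only: inc_def ev)
      qed
      then have "(a h k - a h l) * (real t - real t') = 0" by (simp add: algebra_simps)
      then show "t = t'" using h by (simp add: Q_def)
    next
      fix t assume t: "t \<in> {..N - s}"
      have "{h\<in>J - Q. inc I a b (pt c t) h} = {h\<in>J. inc I a b (pt c t) h} - {h\<in>Q. inc I a b (pt c 0) h}"
        using same t by auto
      moreover have "{h\<in>Q. inc I a b (pt c 0) h} \<subseteq> {h\<in>J. inc I a b (pt c t) h}"
        using same t SQ by auto
      ultimately have "card {h\<in>J - Q. inc I a b (pt c t) h} =
          card {h\<in>J. inc I a b (pt c t) h} - card {h\<in>Q. inc I a b (pt c 0) h}"
        using fJ card_Diff_finite_subset[of "{h\<in>J. inc I a b (pt c t) h}"] by simp
      moreover have "3 \<le> card {h\<in>J. inc I a b (pt c t) h}"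
        using covers_count[OF cov[folded I_def] pt[OF c]] t by simp
      ultimately show "2 \<le> card {h\<in>J - Q. inc I a b (pt c t) h}" using * by linarith
    qed (use fJ in auto)
    moreover have "card (J - Q) = card J - card Q" using fJ SQ by (simp add: card_Diff_finite_subset)
    moreover have "card J < card Q + 2 * (N + 1 - s)" using long by (simp add: Q_def)
    ultimately show False using s by simp
  qed
  \<comment> \<open>By \<open>no\<close>, members of \<open>S\<close> miss all these points, and a
    member of \<open>Q - S\<close> meets at most one of them. So the two members of \<open>Q\<close>
    through each point come from \<open>Q - S\<close>, against \<open>wide\<close>.\<close>
  have "2 * card {..s} \<le> card (Q - S)"
  proof (rule incidence_bound[where R = "\<lambda>h c. inc I a b (pt c 0) h"])
    fix h c c' assume h: "h \<in> Q - S" and t: "c \<in> {..s}" "c' \<in> {..s}"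
      and inc: "inc I a b (pt c 0) h" "inc I a b (pt c' 0) h"
    have "a h i * real c + a h j * (real s - real c) = a h i * real c' + a h j * (real s - real c')"
      using inc t by (simp add: inc_def ev of_nat_diff)
    then have "(a h i - a h j) * (real c - real c') = 0" by (simp add: algebra_simps)
    then show "c = c'" using h by (auto simp: Q_def S_def)
  next
    fix c assume c: "c \<in> {..s}"
    have "\<not> inc I a b (pt c 0) h" if "h \<in> S" for h
    proof
      assume "inc I a b (pt c 0) h"
      then have "a h i * real s + a h k * real (N - s) = b h"
        using that c by (simp add: inc_def ev S_def of_nat_diff algebra_simps)
      then show False using no that by (auto simp: S_def)
    qed
    then have "{h \<in> Q - S. inc I a b (pt c 0) h} = {h \<in> Q. inc I a b (pt c 0) h}" by auto
    then show "2 \<le> card {h \<in> Q - S. inc I a b (pt c 0) h}" using two c by simp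
  qed (use SQ in auto)
  moreover have "card (Q - S) = card Q - card S" using SQ by (simp add: card_Diff_finite_subset)
  moreover have "card Q < card S + 2 * (s + 1)" using wide by (simp add: Q_def S_def)
  ultimately show False by simp
qed

lemma halves_set: "{s::int. lo < 2 * s \<and> 2 * s < hi} = {(lo + 2) div 2 .. (hi - 1) div 2}"
  by auto

lemma card_halves:
  fixes lo hi :: int
  shows "hi - lo - 2 \<le> 2 * int (card {s. lo < 2 * s \<and> 2 * s < hi})"
    and "2 * int (card {s. lo < 2 * s \<and> 2 * s < hi}) \<le> max 0 (hi - lo)"
proof -
  define u v where "u = (lo + 2) div 2" and "v = (hi - 1) div 2"
  have "lo + 1 \<le> 2 * u" "2 * u \<le> lo + 2" "hi - 2 \<le> 2 * v" "2 * v \<le> hi - 1"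
    unfolding u_def v_def by auto
  moreover have "int (card {s. lo < 2 * s \<and> 2 * s < hi}) = max 0 (v - u + 1)"
    unfolding halves_set u_def v_def by simp
  ultimately show "hi - lo - 2 \<le> 2 * int (card {s. lo < 2 * s \<and> 2 * s < hi})"
    "2 * int (card {s. lo < 2 * s \<and> 2 * s < hi}) \<le> max 0 (hi - lo)" by linarith+
qed

text \<open>The levels \<open>s\<close> whose plane \<open>x i + x j = s\<close> lies in the cover
  number at most \<open>S\<close>, yet they contain two intervals of about
  \<open>(S + e) / 2\<close> integers each, whose overlap is bounded in terms of
  \<open>U\<close>.\<close>

lemma tetrahedron_levels_overlap:
  assumes cov: "covers {i, j, k, l} N 3 J a b" and dist: "distinct [i, j, k, l]"
  defines "S \<equiv> card {h\<in>J. a h i = a h j \<and> a h k = a h l}"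
    and "U \<equiv> card {h\<in>J. a h i = a h j \<or> a h k = a h l}"
    and "e \<equiv> 2 * (int N + 1) - int (card J)"
  assumes e: "e > 0"
  shows "e \<le> int S" "int (card J) + e \<le> int S + int U + 2"
proof -
  define p where "p = int (card {h\<in>J. a h i = a h j})"
  define q where "q = int (card {h\<in>J. a h k = a h l})"
  define L where "L = int (card J)"
  have fJ: "finite J" using covers_finite[OF cov] .
  have pq: "p + q = int U + int S"
  proof -
    have "{h\<in>J. a h i = a h j} \<union> {h\<in>J. a h k = a h l} = {h\<in>J. a h i = a h j \<or> a h k = a h l}"
      "{h\<in>J. a h i = a h j} \<inter> {h\<in>J. a h k = a h l} = {h\<in>J. a h i = a h j \<and> a h k = a h l}" by auto
    then show ?thesis using card_Un_Int[of "{h\<in>J. a h i = a h j}" "{h\<in>J. a h k = a h l}"] fJ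
      unfolding p_def q_def U_def S_def by simp
  qed
  have le: "p \<le> L" "q \<le> L" "int S \<le> p" "int S \<le> q"
    unfolding p_def q_def L_def S_def using fJ by (auto intro!: card_mono)
  define V where "V = {s::int. 0 \<le> s \<and> s \<le> int N \<and>
    (\<exists>h\<in>J. a h i = a h j \<and> a h k = a h l \<and> a h i * of_int s + a h k * (real N - of_int s) = b h)}"
  \<comment> \<open>\<open>A\<close> collects the \<open>s\<close> meeting \<open>long\<close> and
    \<open>wide\<close>; \<open>B\<close> does the same with the pairs exchanged and
    \<open>s\<close> replaced by \<open>N - s\<close>.\<close>
  define A where "A = {s::int. q - int S - 2 < 2 * s \<and> 2 * s < 2 * (int N + 1) - L + q}"
  define B where "B = {s::int. L - p - 2 < 2 * s \<and> 2 * s < 2 * (int N + 1) - p + int S}"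
  have AV: "A \<subseteq> V"
  proof
    fix s assume s: "s \<in> A"
    then have "0 \<le> s" "s \<le> int N" using le by (auto simp: A_def)
    then obtain t where t: "s = int t" "t \<le> N" by (metis nat_0_le nat_le_iff)
    have "\<exists>h\<in>J. a h i = a h j \<and> a h k = a h l \<and> a h i * real t + a h k * real (N - t) = b h"
      by (rule tetrahedron_pair_level[OF cov dist t(2)])
         (use s t in \<open>auto simp: A_def q_def L_def S_def\<close>)
    then show "s \<in> V" using t by (auto simp: V_def of_nat_diff)
  qed
  have BV: "B \<subseteq> V"
  proof
    fix s assume s: "s \<in> B"
    then have "0 \<le> s" "s \<le> int N" using le by (auto simp: B_def)
    then obtain t where t: "s = int t" "t \<le> N" by (metis nat_0_le nat_le_iff)
    have perm: "{k, l, i, j} = {i, j, k, l}" by auto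
    have comm: "{h\<in>J. a h k = a h l \<and> a h i = a h j} = {h\<in>J. a h i = a h j \<and> a h k = a h l}" by auto
    have "\<exists>h\<in>J. a h k = a h l \<and> a h i = a h j \<and> a h k * real (N - t) + a h i * real (N - (N - t)) = b h"
      by (rule tetrahedron_pair_level)
         (use cov dist s t in \<open>auto simp: B_def p_def L_def S_def perm comm of_nat_diff\<close>)
    then show "s \<in> V" using t by (auto simp: V_def of_nat_diff add.commute)
  qed
  have fV: "finite V" by (rule finite_subset[of _ "{0..int N}"]) (auto simp: V_def)
  have VS: "card V \<le> S"
  proof -
    define g where "g s = (SOME h. h\<in>J \<and> a h i = a h j \<and> a h k = a h l \<and>
      a h i * of_int s + a h k * (real N - of_int s) = b h)" for s :: int
    have g: "g s \<in> J \<and> a (g s) i = a (g s) j \<and> a (g s) k = a (g s) l \<and>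
      a (g s) i * of_int s + a (g s) k * (real N - of_int s) = b (g s)" if "s \<in> V" for s
      unfolding g_def by (rule someI_ex) (use that in \<open>auto simp: V_def\<close>)
    have "inj_on g V"
    proof (rule inj_onI)
      fix s t assume st: "s \<in> V" "t \<in> V" "g s = g t"
      \<comment> \<open>Equality would make the form constant on all four coordinates.\<close>
      have ne: "a (g s) i \<noteq> a (g s) k"
        using covers_nonconst[OF cov, of "g s"] g[OF st(1)] by auto
      have "a (g s) i * of_int s + a (g s) k * (real N - of_int s) =
          a (g s) i * of_int t + a (g s) k * (real N - of_int t)"
        using g[OF st(1)] g[OF st(2)] unfolding st(3) by linarith
      then have "(a (g s) i - a (g s) k) * (of_int s - of_int t) = 0" by (simp add: algebra_simps)
      with ne show "s = t" by simp
    qed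
    then show ?thesis unfolding S_def
      by (rule card_inj_on_le) (use g fJ in auto)
  qed
  have cA: "e + int S \<le> 2 * int (card A)"
    using card_halves(1)[of "2 * (int N + 1) - L + q" "q - int S - 2"] by (simp add: A_def e_def L_def)
  have cB: "e + int S \<le> 2 * int (card B)"
    using card_halves(1)[of "2 * (int N + 1) - p + int S" "L - p - 2"] by (simp add: B_def e_def L_def)
  show "e \<le> int S" using cA VS card_mono[OF fV AV] by linarith
  have "A \<inter> B \<subseteq> {s. L - p - 2 < 2 * s \<and> 2 * s < 2 * (int N + 1) - L + q}"
    by (auto simp: A_def B_def)
  then have "card (A \<inter> B) \<le> card {s. L - p - 2 < 2 * s \<and> 2 * s < 2 * (int N + 1) - L + q}"
    by (rule card_mono[rotated]) (simp add: halves_set)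
  then have cAB: "2 * int (card (A \<inter> B)) \<le> max 0 (2 * (int N + 1) - 2 * L + p + q + 2)"
    using card_halves(2)[of "L - p - 2" "2 * (int N + 1) - L + q"] by linarith
  have "card A + card B = card (A \<union> B) + card (A \<inter> B)"
    by (rule card_Un_Int) (use fV AV BV in \<open>auto intro: finite_subset\<close>)
  moreover have "card (A \<union> B) \<le> S"
    using card_mono[OF fV, of "A \<union> B"] AV BV VS by simp
  \<comment> \<open>The overlap has at least \<open>e\<close> elements, because \<open>A\<close> and
    \<open>B\<close> each have at least \<open>(e + S) / 2\<close> and their union at most
    \<open>S\<close>. As \<open>e > 0\<close>, the maximum is then not 0.\<close>
  ultimately have "2 * e \<le> max 0 (2 * (int N + 1) - 2 * L + p + q + 2)"
    using cA cB cAB by linarith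
  then show "int (card J) + e \<le> int S + int U + 2"
    using e pq by (simp add: e_def L_def)
qed

lemma card_disjoint_three_le:
  assumes "finite J" "X \<subseteq> J" "Y \<subseteq> J" "Z \<subseteq> J"
    and "X \<inter> Y = {}" "X \<inter> Z = {}" "Y \<inter> Z = {}"
  shows "card X + card Y + card Z \<le> card J"
proof -
  have fin: "finite X" "finite Y" "finite Z" using assms by (auto intro: finite_subset)
  have "card X + card Y + card Z = card (X \<union> Y \<union> Z)"
    using fin assms by (simp add: card_Un_disjoint Int_Un_distrib2)
  also have "\<dots> \<le> card J" using assms by (intro card_mono) auto
  finally show ?thesis .
qed

lemma covers_3_tetrahedron:
  assumes cov: "covers I N 3 J a b" and I: "card I = 4"
  shows "2 * (N + 1) \<le> card J + 1"
proof (rule ccontr)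
  assume neg: "\<not> ?thesis"
  obtain i j k l where I4: "I = {i, j, k, l}" and dist: "distinct [i, j, k, l]"
  proof -
    obtain xs where "set xs = I" "distinct xs" "length xs = 4"
      using I by (metis card.infinite distinct_card finite_distinct_list zero_neq_numeral)
    then show ?thesis using that by (auto simp: numeral_eq_Suc length_Suc_conv)
  qed
  note cov4 = cov[unfolded I4]
  have perm: "{i, k, j, l} = {i, j, k, l}" "{i, l, j, k} = {i, j, k, l}" by auto
  have fJ: "finite J" using covers_finite[OF cov] .
  define e where "e = 2 * (int N + 1) - int (card J)"
  have e: "e \<ge> 2" using neg by (simp add: e_def)
  let ?S1 = "{h\<in>J. a h i = a h j \<and> a h k = a h l}" and ?U1 = "{h\<in>J. a h i = a h j \<or> a h k = a h l}"
  let ?S2 = "{h\<in>J. a h i = a h k \<and> a h j = a h l}" and ?U2 = "{h\<in>J. a h i = a h k \<or> a h j = a h l}"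
  let ?S3 = "{h\<in>J. a h i = a h l \<and> a h j = a h k}"
  have r1: "e \<le> int (card ?S1)" "int (card J) + e \<le> int (card ?S1) + int (card ?U1) + 2"
    using tetrahedron_levels_overlap[OF cov4 dist] e by (auto simp: e_def)
  have r2: "e \<le> int (card ?S2)" "int (card J) + e \<le> int (card ?S2) + int (card ?U2) + 2"
    using tetrahedron_levels_overlap[of i k j l N J a b] dist cov4 e by (auto simp: e_def perm)
  have r3: "e \<le> int (card ?S3)"
    using tetrahedron_levels_overlap(1)[of i l j k N J a b] dist cov4 e by (auto simp: e_def perm)
  have nc: "\<not> (a h i = a h j \<and> a h i = a h k \<and> a h i = a h l)" if "h \<in> J" for h
    using covers_nonconst[OF cov4 that] by auto
  \<comment> \<open>An edge equality from one splitting together with both equalities of another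
    forces all four coefficients to agree, which \<open>nc\<close> excludes.\<close>
  have "h \<notin> ?U1 \<inter> ?S2" "h \<notin> ?U1 \<inter> ?S3" "h \<notin> ?U2 \<inter> ?S1" "h \<notin> ?U2 \<inter> ?S3" for h
    using nc[of h] by (simp_all only: Int_iff mem_Collect_eq) metis+
  then have "?U1 \<inter> ?S2 = {}" "?U1 \<inter> ?S3 = {}" "?U2 \<inter> ?S1 = {}" "?U2 \<inter> ?S3 = {}" by blast+
  moreover have "?S2 \<subseteq> ?U2" "?S1 \<subseteq> ?U1" by auto
  ultimately have u1: "card ?U1 + card ?S2 + card ?S3 \<le> card J"
    and u2: "card ?U2 + card ?S1 + card ?S3 \<le> card J"
    by - (rule card_disjoint_three_le[OF fJ]; blast)+
  \<comment> \<open>Eliminating \<open>?U1\<close> and \<open>?U2\<close> and adding gives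
    \<open>card ?S3 + e \<le> 2\<close>; with \<open>r3\<close> this yields
    \<open>e \<le> 1\<close>.\<close>
  show False using r1(2) r2(2) r3 u1 u2 e by linarith
qed

section \<open>Multiplicity 3 in higher dimensions\<close>

text \<open>With \<open>d = e + 3\<close> this reads
  \<open>(d + 1) * n \<le> (d - 1) * (card J + 2)\<close>. Slicing only adds parallel members to the
  count, so the error 2 does not grow with the dimension.\<close>

lemma covers_3_lower:
  assumes "covers I N 3 J a b" and "card I = e + 4"
  shows "(e + 4) * (N + 1) \<le> (e + 2) * (card J + 2)"
  using assms
proof (induction e arbitrary: I N J b)
  case 0
  then show ?case using covers_3_tetrahedron by fastforce
next
  case (Suc e)
  note cov = Suc.prems(1)
  have I: "finite I" using Suc.prems(2) by (metis card.infinite nat.distinct(1) add_Suc)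
  have fJ: "finite J" using covers_finite[OF cov] .
  show ?case
  proof (cases "\<exists>i\<in>I. \<exists>c. (e + 3) * c < N + 1 \<and> level I N J a b i c = {}")
    case False
    define m where "m = N div (e + 3) + 1"
    have small: "(e + 3) * c < N + 1" if "c < m" for c
    proof -
      have "(e + 3) * c \<le> (e + 3) * (N div (e + 3))" by (rule mult_le_mono2) (use that m_def in simp)
      also have "\<dots> \<le> N" by (rule times_div_less_eq_dividend)
      finally show ?thesis by simp
    qed
    have pm: "m \<le> card {j\<in>J. par I a i j}" if "i \<in> I" for i
      using levels_card[OF cov I that, of "{..<m}"] False small that by auto
    \<comment> \<open>A form parallel to two facets is constant on \<open>I\<close>, because a third
      index \<open>p\<close> links the two conditions.\<close>
    have disj: "{j\<in>J. par I a i j} \<inter> {j\<in>J. par I a i' j} = {}" if ii: "i \<in> I" "i' \<in> I" "i \<noteq> i'" for i i'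
    proof (rule ccontr)
      assume "\<not> ?thesis"
      then obtain j where j: "j \<in> J" "par I a i j" "par I a i' j" by auto
      have "card (I - {i, i'}) > 0" using Suc.prems(2) I ii by (simp add: card_Diff_subset)
      then obtain p where p: "p \<in> I" "p \<noteq> i" "p \<noteq> i'" by (auto simp: card_gt_0_iff)
      have "a j q = a j p" if q: "q \<in> I" for q
      proof (cases "q = i")
        case True
        then have "q \<in> I - {i'}" "p \<in> I - {i'}" using ii p by auto
        then show ?thesis using j(3) unfolding par_def by blast
      next
        case False
        then have "q \<in> I - {i}" "p \<in> I - {i}" using q p by auto
        then show ?thesis using j(2) unfolding par_def by blast
      qed
      then show False using covers_nonconst[OF cov j(1)] by metis
    qed
    have "(e + 5) * m = (\<Sum>i\<in>I. m)" using Suc.prems(2) by simp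
    also have "\<dots> \<le> (\<Sum>i\<in>I. card {j\<in>J. par I a i j})" by (rule sum_mono) (use pm in auto)
    also have "\<dots> = card (\<Union>i\<in>I. {j\<in>J. par I a i j})"
      by (rule card_UN_disjoint[symmetric]) (use I fJ disj in auto)
    also have "\<dots> \<le> card J" by (rule card_mono) (use fJ in auto)
    finally have L: "(e + 5) * m \<le> card J" .
    have "N + 1 \<le> (e + 3) * m"
      using dividend_less_times_div[of "e + 3" N] by (simp add: m_def)
    then have "(e + 5) * (N + 1) \<le> (e + 5) * ((e + 3) * m)" by (rule mult_le_mono2)
    also have "\<dots> = (e + 3) * ((e + 5) * m)" by (simp only: ac_simps)
    also have "\<dots> \<le> (e + 3) * (card J + 2)" by (rule mult_le_mono2) (use L in simp)
    finally show ?thesis by (simp add: eval_nat_numeral)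
  next
    case True
    then obtain i c where i: "i \<in> I" and c: "(e + 3) * c < N + 1" "level I N J a b i c = {}" by blast
    obtain m where m: "m \<le> c" "level I N J a b i m = {}" "\<And>c'. c' < m \<Longrightarrow> level I N J a b i c' \<noteq> {}"
      using first_empty_level[of "level I N J a b i", OF c(2)] by blast
    have em: "(e + 3) * m \<le> N" using mult_le_mono2[OF m(1), of "e + 3"] c(1) by linarith
    then have mN: "m \<le> N" by (simp add: algebra_simps)
    have A: "m \<le> card {j\<in>J. par I a i j}"
      using levels_card[OF cov I i, of "{..<m}"] m by simp
    have B: "(e + 4) * (N - m + 1) \<le> (e + 2) * (card {j\<in>J. \<not> par I a i j} + 2)"
      using Suc.IH[OF covers_slice[OF cov I i mN m(2)]] Suc.prems(2) I i by simp
    obtain r where r: "N = m + r" using mN le_Suc_ex by blast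
    have "(e + 2) * m + (e + 4) * (N - m + 1) \<le> (e + 2) * (card J + 2)"
      unfolding card_par_split[OF cov, of i] add.assoc distrib_left[of "e + 2" "card {j\<in>J. par I a i j}"]
      by (rule add_mono[OF mult_le_mono2[OF A] B[unfolded add.assoc]])
    then have "(e + 2) * m + (e + 4) * (r + 1) \<le> (e + 2) * (card J + 2)" by (simp add: r)
    then have C: "(e + 3) * ((e + 2) * m + (e + 4) * (r + 1)) \<le> (e + 3) * ((e + 2) * (card J + 2))"
      by (rule mult_le_mono2)
    \<comment> \<open>The difference of the two sides is \<open>2 * (r + 1 - (e + 2) * m)\<close>,
      positive since \<open>em\<close> says \<open>(e + 2) * m \<le> r\<close>.\<close>
    have "(e + 2) * ((e + 5) * (N + 1)) \<le> (e + 3) * ((e + 2) * m + (e + 4) * (r + 1))"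
      using em unfolding r by (simp add: algebra_simps)
    also note C
    also have "(e + 3) * ((e + 2) * (card J + 2)) = (e + 2) * ((e + 3) * (card J + 2))"
      by (simp only: ac_simps)
    finally have "(e + 5) * (N + 1) \<le> (e + 3) * (card J + 2)"
      by (simp only: mult_le_cancel1)
    then show ?thesis by (simp add: eval_nat_numeral)
  qed
qed

section \<open>Passage to barycentric coordinates, and covers by facet slabs\<close>

text \<open>List positions serve as indices, so repeated hyperplanes remain distinct
  members.\<close>

lemma is_k_cover_covers:
  assumes M: "is_k_cover n d k M" and n: "n = N + 1"
  obtains J :: "nat set" and a b where "covers {..d} N k J a b" "card J = size M"
proof -
  obtain xs where xs: "mset xs = M" using ex_mset by blast
  \<comment> \<open>The slack coordinate \<open>d\<close> gets coefficient 0, so a nonzero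
    coefficient below \<open>d\<close> makes the form nonconstant.\<close>
  define a where "a j i = (if i < d then fst (xs ! j) i else 0)" for j i
  define b where "b j = snd (xs ! j)" for j
  have "covers {..d} N k {..<length xs} a b"
    unfolding covers_def
  proof (intro conjI ballI allI impI)
    fix j assume "j \<in> {..<length xs}"
    then have "is_hyperplane d (xs ! j)" using M xs by (auto simp: is_k_cover_def)
    then show "\<exists>p\<in>{..d}. \<exists>q\<in>{..d}. a j p \<noteq> a j q"
      unfolding is_hyperplane_def by (metis a_def atMost_iff less_imp_le less_irrefl order_refl)
  next
    fix x :: "nat \<Rightarrow> nat" assume x: "sum x {..d} = N"
    define y where "y i = (if i < d then real (x i) else 0)" for i
    have "(\<Sum>i<d. x i) + 1 \<le> n" using x n by (simp add: lessThan_Suc_atMost[symmetric])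
    then have "real (\<Sum>i<d. x i) \<le> real n - 1" by linarith
    moreover have "(\<Sum>i<d. y i) = real (\<Sum>i<d. x i)" by (simp add: y_def)
    ultimately have y: "y \<in> T d n" by (auto simp: T_def y_def)
    have on: "on_hyperplane d (xs ! j) y \<longleftrightarrow> inc {..d} a b x j" for j
      by (simp add: on_hyperplane_def inc_def y_def a_def b_def lessThan_Suc_atMost[symmetric])
    have "k \<le> size (filter_mset (\<lambda>h. on_hyperplane d h y) M)" using M y by (simp add: is_k_cover_def)
    also have "\<dots> = length (filter (\<lambda>h. on_hyperplane d h y) xs)"
      by (simp add: xs[symmetric] flip: mset_filter)
    also have "\<dots> = card {j\<in>{..<length xs}. inc {..d} a b x j}"
      by (simp add: length_filter_conv_card on)
    finally show "k \<le> card {j\<in>{..<length xs}. inc {..d} a b x j}" .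
  qed simp
  moreover have "card {..<length xs} = size M" using xs by auto
  ultimately show ?thesis by (rule that)
qed

text \<open>At a given point let \<open>B\<close> be the set of directions whose slabs miss it.
  There the barycentric coordinates are at least \<open>m\<close>, so \<open>sum m B < n\<close>,
  and each direction outside \<open>B\<close> supplies one plane through the point.\<close>

lemma facet_slabs_cover:
  fixes m :: "nat \<Rightarrow> nat"
  assumes d: "d \<ge> 1"
    and slack: "\<And>B. B \<subseteq> {..d} \<Longrightarrow> sum m B < n \<Longrightarrow> k \<le> card ({..d} - B)"
  shows "\<exists>M. is_k_cover n d k M \<and> size M = sum m {..d}"
proof -
  \<comment> \<open>For \<open>i = d\<close> the plane on which the slack coordinate equals
    \<open>c\<close> is written in the original coordinates.\<close>
  define pl :: "nat \<times> nat \<Rightarrow> (nat \<Rightarrow> real) \<times> real" where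
    "pl = (\<lambda>(i, c). if i < d then (\<lambda>t. if t = i then 1 else 0, real c) else (\<lambda>_. 1, real n - 1 - real c))"
  define X where "X = (SIGMA i:{..d}. {..<m i})"
  define M where "M = image_mset pl (mset_set X)"
  have fX: "finite X" by (auto simp: X_def)
  have "size M = sum m {..d}" by (simp add: M_def X_def)
  moreover have "is_k_cover n d k M"
    unfolding is_k_cover_def
  proof (intro conjI ballI)
    fix h assume "h \<in># M"
    then show "is_hyperplane d h"
      using d by (auto simp: M_def fX is_hyperplane_def pl_def Suc_le_eq)
  next
    fix x assume x: "x \<in> T d n"
    then obtain y0 where y0: "\<And>i. i < d \<Longrightarrow> x i = real (y0 i)" unfolding T_def by simp metis
    have sy: "sum y0 {..<d} + 1 \<le> n"
    proof -
      have "(\<Sum>i<d. x i) = real (sum y0 {..<d})" using y0 by simp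
      moreover have "(\<Sum>i<d. x i) \<le> real n - 1" using x by (simp add: T_def)
      ultimately show ?thesis by linarith
    qed
    define y where "y = y0(d := n - 1 - sum y0 {..<d})"
    have "sum y {..<d} = sum y0 {..<d}" by (rule sum.cong) (auto simp: y_def)
    then have ysum: "sum y {..d} = n - 1" using sy by (simp add: lessThan_Suc_atMost[symmetric] y_def)
    have on: "on_hyperplane d (pl (i, y i)) x" if "i \<le> d" for i
    proof (cases "i < d")
      case True
      have "(\<Sum>t<d. (if t = i then 1 else 0) * x t) = (\<Sum>t<d. if t = i then x t else 0)"
        by (rule sum.cong) auto
      then show ?thesis using True y0 by (simp add: on_hyperplane_def pl_def y_def)
    next
      case False
      then have "i = d" using that by simp
      moreover have "(\<Sum>t<d. x t) = real (sum y0 {..<d})" using y0 by simp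
      ultimately show ?thesis using sy by (simp add: on_hyperplane_def pl_def y_def of_nat_diff)
    qed
    define B where "B = {i\<in>{..d}. m i \<le> y i}"
    have "sum m B \<le> sum y B" by (rule sum_mono) (simp add: B_def)
    also have "\<dots> \<le> sum y {..d}" by (rule sum_mono2) (auto simp: B_def)
    also have "\<dots> < n" using ysum sy by simp
    finally have "k \<le> card ({..d} - B)" by (intro slack) (auto simp: B_def)
    also have "\<dots> \<le> card {p\<in>X. on_hyperplane d (pl p) x}"
      by (rule card_inj_on_le[of "\<lambda>i. (i, y i)"])
         (use fX on in \<open>auto simp: inj_on_def X_def B_def\<close>)
    also have "\<dots> = size (filter_mset (\<lambda>h. on_hyperplane d h x) M)"
      using fX by (simp add: M_def filter_mset_image_mset filter_mset_mset_set o_def)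
    finally show "k \<le> size (filter_mset (\<lambda>h. on_hyperplane d h x) M)" .
  qed
  ultimately show ?thesis by blast
qed

section \<open>The extremal values\<close>

lemma f3_le: "is_k_cover n d k M \<Longrightarrow> f3 n d k \<le> size M"
  unfolding f3_def by (rule Least_le) blast

lemma f3_attained:
  assumes "is_k_cover n d k M"
  obtains M' where "is_k_cover n d k M'" "size M' = f3 n d k"
proof -
  have "\<exists>M'. is_k_cover n d k M' \<and> size M' = f3 n d k"
    unfolding f3_def by (rule LeastI_ex) (use assms in blast)
  then show ?thesis using that by blast
qed

lemma f3_attained_covers:
  assumes "is_k_cover n d k M" and n: "n = N + 1"
  obtains J :: "nat set" and a b where "covers {..d} N k J a b" "card J = f3 n d k"
proof -
  obtain M' where M': "is_k_cover n d k M'" "size M' = f3 n d k"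
    using f3_attained[OF assms(1)] by blast
  obtain J :: "nat set" and a b where "covers {..d} N k J a b" "card J = size M'"
    using is_k_cover_covers[OF M'(1) n] by blast
  then show ?thesis using that M'(2) by simp
qed

lemma f_eq:
  assumes "n \<ge> 1" "d \<ge> 1"
  shows "f n d = n"
proof -
  obtain N where N: "n = N + 1" using assms(1) by (metis add.commute le_Suc_ex)
  let ?m = "\<lambda>i::nat. if i = 0 then n else 0"
  have "1 \<le> card ({..d} - B)" if "B \<subseteq> {..d}" "sum ?m B < n" for B
  proof -
    have "0 \<notin> B"
    proof
      assume "0 \<in> B"
      then have "sum ?m {0} \<le> sum ?m B"
        using that(1) by (intro sum_mono2) (auto intro: finite_subset)
      then show False using that(2) by simp
    qed
    then have "card ({..d} - B) > 0" by (auto simp: card_gt_0_iff)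
    then show ?thesis by simp
  qed
  then obtain M where M: "is_k_cover n d 1 M" "size M = sum ?m {..d}"
    using facet_slabs_cover[of d ?m n 1] assms by blast
  have "sum ?m {..d} = n" by (subst sum.delta) auto
  then have "f3 n d 1 \<le> n" using f3_le[OF M(1)] M(2) by simp
  moreover obtain J :: "nat set" and a b where "covers {..d} N 1 J a b" "card J = f3 n d 1"
    using f3_attained_covers[OF M(1) N] by blast
  then have "n \<le> f3 n d 1" using covers_1_lower[of "{..d}" N J a b d] N by simp
  ultimately show ?thesis by (simp add: f_def)
qed

lemma f3_2_eq:
  assumes "n \<ge> 1" "d \<ge> 1"
  shows "int (f3 n d 2) = int n + \<lceil>real n / real d\<rceil>"
proof -
  obtain N where N: "n = N + 1" using assms(1) by (metis add.commute le_Suc_ex)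
  define q where "q = nat \<lceil>real n / real d\<rceil>"
  have "0 \<le> \<lceil>real n / real d\<rceil>" by (rule order_trans[OF _ ceiling_mono[of 0]]) simp_all
  then have q: "int q = \<lceil>real n / real d\<rceil>" by (simp add: q_def)
  have dq: "n \<le> d * q"
  proof -
    have "real n / real d \<le> real q" unfolding q_def by (rule real_nat_ceiling_ge)
    then have "real n \<le> real (d * q)" using assms by (simp add: field_simps)
    then show ?thesis by linarith
  qed
  have least: "q \<le> r" if "n \<le> d * r" for r
  proof -
    have "real n \<le> real d * real r" using that by (metis of_nat_le_iff of_nat_mult)
    then have "real n / real d \<le> real r" using assms by (simp add: field_simps)
    then show ?thesis by (simp add: q_def ceiling_le_iff)
  qed
  \<comment> \<open>Slabs of thickness \<open>q\<close> are filled greedily up to total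
    \<open>n + q\<close>; \<open>d + 1\<close> directions suffice by \<open>dq\<close>. Omitting one
    direction still leaves thickness at least \<open>n\<close>.\<close>
  define m where "m i = min q ((n + q) - i * q)" for i
  have msum: "sum m {..<j} = min (j * q) (n + q)" for j
    by (induction j) (auto simp: m_def)
  have mtot: "sum m {..d} = n + q"
    using msum[of "Suc d"] dq by (simp add: lessThan_Suc_atMost)
  have "2 \<le> card ({..d} - B)" if B: "B \<subseteq> {..d}" "sum m B < n" for B
  proof (rule ccontr)
    assume "\<not> ?thesis"
    then have "card ({..d} - B) * q \<le> 1 * q" by (intro mult_le_mono1) linarith
    then have "card ({..d} - B) * q \<le> q" by simp
    moreover have "sum m ({..d} - B) \<le> card ({..d} - B) * q"
      using sum_bounded_above[of "{..d} - B" m q] by (simp add: m_def)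
    moreover have "sum m {..d} = sum m ({..d} - B) + sum m B"
      using B(1) by (simp add: sum.subset_diff)
    ultimately show False using mtot B(2) by linarith
  qed
  then obtain M where M: "is_k_cover n d 2 M" "size M = sum m {..d}"
    using facet_slabs_cover[of d m n 2] assms by blast
  have up: "f3 n d 2 \<le> n + q" using f3_le[OF M(1)] M(2) mtot by simp
  obtain J :: "nat set" and a b where J: "covers {..d} N 2 J a b" "card J = f3 n d 2"
    using f3_attained_covers[OF M(1) N] by blast
  have lo: "(d + 1) * n \<le> d * f3 n d 2" using covers_2_lower[OF J(1), of d] J(2) N by simp
  have "d * n \<le> d * f3 n d 2" by (rule order_trans[OF _ lo]) simp
  then have "n \<le> f3 n d 2" using assms by (simp only: mult_le_cancel1)
  then obtain r where r: "f3 n d 2 = n + r" using le_Suc_ex by blast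
  then have "n \<le> d * r" using lo by (simp add: algebra_simps)
  then have "q \<le> r" by (rule least)
  then have "f3 n d 2 = n + q" using up r by simp
  then show ?thesis by (simp add: q)
qed

text \<open>Equal slabs give the upper bound, with rounding costing at most \<open>d + 1\<close>;
  the lower bound loses at most 2.\<close>

lemma f3_3_bound:
  assumes "n \<ge> 1" "d \<ge> 3"
  shows "\<bar>real (f3 n d 3) - (1 + 2 / (real d - 1)) * real n\<bar> \<le> real d + 1"
proof -
  obtain N where N: "n = N + 1" using assms(1) by (metis add.commute le_Suc_ex)
  obtain e where e: "d = e + 3" using assms(2) by (metis add.commute le_Suc_ex)
  \<comment> \<open>This is the ceiling of \<open>n / (d - 1)\<close>, so any \<open>d - 1\<close>
    slabs have total thickness at least \<open>n\<close>.\<close>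
  define m where "m = N div (e + 2) + 1"
  have em: "n \<le> (e + 2) * m"
    using dividend_less_times_div[of "e + 2" N] by (simp add: m_def N)
  have me: "(e + 2) * m \<le> n + (e + 2)"
    using times_div_less_eq_dividend[of "e + 2" N] by (simp add: m_def N)
  have "3 \<le> card ({..d} - B)" if B: "B \<subseteq> {..d}" "sum (\<lambda>_. m) B < n" for B
  proof (rule ccontr)
    assume "\<not> ?thesis"
    moreover have "card ({..d} - B) = d + 1 - card B"
      using B(1) by (simp add: card_Diff_subset finite_subset)
    ultimately have "e + 2 \<le> card B" using e by simp
    then have "(e + 2) * m \<le> card B * m" by (rule mult_le_mono1)
    then show False using B(2) em by simp
  qed
  then obtain M where M: "is_k_cover n d 3 M" "size M = sum (\<lambda>_. m) {..d}"
    using facet_slabs_cover[of d "\<lambda>_. m" n 3] assms by auto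
  have up: "f3 n d 3 \<le> (e + 4) * m" using f3_le[OF M(1)] M(2) e by (simp add: add.commute)
  obtain J :: "nat set" and a b where J: "covers {..d} N 3 J a b" "card J = f3 n d 3"
    using f3_attained_covers[OF M(1) N] by blast
  have lo: "(e + 4) * n \<le> (e + 2) * (f3 n d 3 + 2)"
    using covers_3_lower[OF J(1), of e] J(2) N e by simp
  have "(e + 2) * f3 n d 3 \<le> (e + 4) * ((e + 2) * m)"
    using mult_le_mono2[OF up, of "e + 2"] by (simp only: ac_simps)
  also have "\<dots> \<le> (e + 4) * (n + (e + 2))" using me by (rule mult_le_mono2)
  finally have up': "real ((e + 2) * f3 n d 3) \<le> real ((e + 4) * (n + (e + 2)))"
    by (simp only: of_nat_le_iff)
  have lo': "real ((e + 4) * n) \<le> real ((e + 2) * (f3 n d 3 + 2))" using lo by (simp only: of_nat_le_iff)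
  have coef: "(1 + 2 / (real d - 1)) * real n = (real e + 4) * real n / (real e + 2)"
    using e by (simp add: field_simps)
  have "real (f3 n d 3) - (real e + 4) * real n / (real e + 2) \<le> real e + 4"
    using up' by (simp add: field_simps)
  moreover have "(real e + 4) * real n / (real e + 2) - real (f3 n d 3) \<le> 2"
    using lo' by (simp add: field_simps)
  ultimately show ?thesis unfolding coef using e by simp
qed

theorem mainTheorem6:
  shows "(\<forall>n\<ge>1. \<forall>d\<ge>1. f n d = n) \<and>
         (\<forall>n\<ge>1. \<forall>d\<ge>1. int (f3 n d 2) = int n + \<lceil>real n / real d\<rceil>) \<and>
         (\<forall>d\<ge>3. \<exists>C::real. \<forall>n\<ge>1.
             \<bar>real (f3 n d 3) - (1 + 2 / (real d - 1)) * real n\<bar> \<le> C)"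
  using f_eq f3_2_eq f3_3_bound by blast

end
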